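(* For every integer $m\geq 5$, the $m$-bonacci word is $c$-balanced with $$c=\lfloor \kappa m\rfloor+12,$$ where $$\kappa=\frac{2}{\pi}\int_{0}^{2\pi}\frac{1-\cos x}{(5-4\cos x)\ln(5-4\cos x)}\,dx\approx 0.58 .$$
   Context: For $m\ge 2$ and the alphabet $\mathcal{A}=\{0,1,\ldots,m-1\}$, the $m$-bonacci word $\mathbf{u}$ is the unique infinite word over $\mathcal{A}$ that is a fixed point of the substitution (monoid morphism) $\varphi$ given by $0\mapsto 01,\ 1\mapsto 02,\ \ldots,\ (m-2)\mapsto 0(m-1),\ (m-1)\mapsto 0$. A factor of an infinite word $\mathbf{u}=\mathbf{u}_0\mathbf{u}_1\mathbf{u}_2\cdots$ is any finite word $\mathbf{u}_i\mathbf{u}_{i+1}\cdots\mathbf{u}_{i+n-1}$; $|w|$ is the length of $w$ and $|w|_a$ is the number of occurrences of the letter $a$ in $w$. For a positive integer $c$, an infinite word over $\mathcal{A}$ is $c$-balanced if $|w|_a-|v|_a\le c$ for all factors $w,v$ of it of the same length and for every letter $a\in\mathcal{A}$. *)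

theory Defs
  imports "HOL-Analysis.Analysis" "HOL-Library.Stream"
begin

(* Letters are natural numbers; the alphabet is {..<m}.  The value of the substitution on a
   letter outside the alphabet is irrelevant. *)
definition bonacci_subst :: "nat \<Rightarrow> nat \<Rightarrow> nat list" where
  "bonacci_subst m a = (if a + 1 < m then [0, a + 1] else [0])"

(* Applying a non-erasing morphism to an infinite word concatenates the images of its letters:
   the result is flat (smap (bonacci_subst m) u). *)
definition is_bonacci_word :: "nat \<Rightarrow> nat stream \<Rightarrow> bool" where
  "is_bonacci_word m u \<longleftrightarrow> sset u \<subseteq> {..<m} \<and> flat (smap (bonacci_subst m) u) = u"

lemma flat_smap_shift:
  "flat (smap (bonacci_subst m) (xs @- s)) =
     concat (map (bonacci_subst m) xs) @- flat (smap (bonacci_subst m) s)"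
  by (induction xs) (auto simp: bonacci_subst_def)

lemma bonacci_subst_hd: "bonacci_subst m a = 0 # tl (bonacci_subst m a)"
  by (simp add: bonacci_subst_def)

definition bonacci_iter :: "nat \<Rightarrow> nat \<Rightarrow> nat list" where
  "bonacci_iter m n = ((\<lambda>w. concat (map (bonacci_subst m) w)) ^^ n) [0]"

lemma bonacci_iter_0: "bonacci_iter m 0 = [0]"
  by (simp add: bonacci_iter_def)

lemma bonacci_iter_Suc:
  "bonacci_iter m (Suc n) = concat (map (bonacci_subst m) (bonacci_iter m n))"
  by (simp add: bonacci_iter_def)

lemma bonacci_iter_extend:
  assumes "m \<ge> 2"
  shows "\<exists>ys. ys \<noteq> [] \<and> bonacci_iter m (Suc n) = bonacci_iter m n @ ys"
proof (induction n)
  case 0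
  show ?case using assms by (simp add: bonacci_iter_Suc bonacci_iter_0 bonacci_subst_def)
next
  case (Suc n)
  then obtain ys where ys: "ys \<noteq> []" "bonacci_iter m (Suc n) = bonacci_iter m n @ ys" by blast
  have "bonacci_iter m (Suc (Suc n)) = concat (map (bonacci_subst m) (bonacci_iter m n @ ys))"
    using ys(2) by (metis bonacci_iter_Suc)
  also have "\<dots> = bonacci_iter m (Suc n) @ concat (map (bonacci_subst m) ys)"
    by (simp add: bonacci_iter_Suc)
  finally have "bonacci_iter m (Suc (Suc n)) = bonacci_iter m (Suc n) @ concat (map (bonacci_subst m) ys)" .
  moreover have "concat (map (bonacci_subst m) ys) \<noteq> []"
    using ys(1) by (cases ys) (auto simp: bonacci_subst_def)
  ultimately show ?case by blast
qed

lemma bonacci_iter_length: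
  assumes "m \<ge> 2"
  shows "n < length (bonacci_iter m n)"
proof (induction n)
  case 0
  show ?case by (simp add: bonacci_iter_0)
next
  case (Suc n)
  obtain ys where "ys \<noteq> []" "bonacci_iter m (Suc n) = bonacci_iter m n @ ys"
    using bonacci_iter_extend[OF assms] by blast
  with Suc show ?case by (cases ys) auto
qed

lemma bonacci_iter_mono:
  assumes "m \<ge> 2"
  shows "\<exists>ys. bonacci_iter m (n + k) = bonacci_iter m n @ ys"
proof (induction k)
  case (Suc k)
  then show ?case using bonacci_iter_extend[OF assms, of "n + k"] by auto
qed simp

lemma bonacci_iter_nth:
  assumes "m \<ge> 2" "i < length (bonacci_iter m n)"
  shows "bonacci_iter m n ! i = bonacci_iter m i ! i"
proof (cases "i \<le> n")
  case True
  then obtain ys where "bonacci_iter m n = bonacci_iter m i @ ys"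
    using bonacci_iter_mono[OF assms(1), of i "n - i"] by auto
  then show ?thesis using bonacci_iter_length[OF assms(1), of i] by (simp add: nth_append)
next
  case False
  then obtain ys where "bonacci_iter m i = bonacci_iter m n @ ys"
    using bonacci_iter_mono[OF assms(1), of n "i - n"] by auto
  then show ?thesis using assms(2) by (simp add: nth_append)
qed

lemma bonacci_iter_set:
  assumes "m \<ge> 1"
  shows "set (bonacci_iter m n) \<subseteq> {..<m}"
  by (induction n) (use assms in \<open>auto simp: bonacci_iter_0 bonacci_iter_Suc bonacci_subst_def split: if_splits\<close>)

lemma stream_eqI_snth: "(\<And>i. s !! i = t !! i) \<Longrightarrow> s = t"
  by (metis ext smap_alt stream.map_ident)

(* The defining property determines the word, so the definite description below is proper. *)
lemma ex1_bonacci_word: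
  assumes "m \<ge> 2"
  shows "\<exists>!u. is_bonacci_word m u"
proof
  let ?u = "smap (\<lambda>i. bonacci_iter m i ! i) nats"
  have nth: "?u !! i = bonacci_iter m i ! i" for i by simp
  have pre: "\<exists>s. ?u = bonacci_iter m n @- s" for n
  proof -
    have "stake (length (bonacci_iter m n)) ?u = bonacci_iter m n"
      using bonacci_iter_nth[OF assms, of _ n] by (intro nth_equalityI) auto
    then show ?thesis by (metis stake_sdrop)
  qed
  have "flat (smap (bonacci_subst m) ?u) !! i = ?u !! i" for i
  proof -
    obtain s where s: "?u = bonacci_iter m i @- s" using pre by blast
    obtain t where t: "?u = bonacci_iter m (Suc i) @- t" using pre by blast
    have "flat (smap (bonacci_subst m) ?u) = bonacci_iter m (Suc i) @- flat (smap (bonacci_subst m) s)"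
      unfolding s flat_smap_shift bonacci_iter_Suc ..
    moreover have "i < length (bonacci_iter m (Suc i))"
      using bonacci_iter_length[OF assms, of "Suc i"] by simp
    ultimately show ?thesis by (metis t shift_snth_less)
  qed
  then have "flat (smap (bonacci_subst m) ?u) = ?u" by (rule stream_eqI_snth)
  moreover have "bonacci_iter m i ! i < m" for i
  proof -
    have "bonacci_iter m i ! i \<in> set (bonacci_iter m i)"
      using bonacci_iter_length[OF assms, of i] by simp
    then show ?thesis using bonacci_iter_set[of m i] assms by auto
  qed
  then have "sset ?u \<subseteq> {..<m}" by (auto simp: stream.set_map)
  ultimately show u: "is_bonacci_word m ?u" by (simp add: is_bonacci_word_def)
  fix v assume v: "is_bonacci_word m v"
  then have fix_v: "flat (smap (bonacci_subst m) v) = v" by (simp add: is_bonacci_word_def)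
  have pre_v: "\<exists>s. v = bonacci_iter m n @- s" for n
  proof (induction n)
    case 0
    have "v = flat (smap (bonacci_subst m) ([shd v] @- stl v))" using fix_v by simp
    also have "\<dots> = bonacci_subst m (shd v) @- flat (smap (bonacci_subst m) (stl v))"
      unfolding flat_smap_shift by simp
    finally have "shd v = 0" by (metis bonacci_subst_hd shift.simps(2) stream.sel(1))
    then have "v = [0] @- stl v" by (metis shift.simps stream.collapse)
    then show ?case by (auto simp: bonacci_iter_0)
  next
    case (Suc n)
    then obtain s where "v = bonacci_iter m n @- s" by blast
    then have "v = bonacci_iter m (Suc n) @- flat (smap (bonacci_subst m) s)"
      using fix_v by (metis flat_smap_shift bonacci_iter_Suc)
    then show ?case by blast
  qed
  show "v = ?u"
  proof (rule stream_eqI_snth)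
    fix i
    obtain s where "v = bonacci_iter m i @- s" using pre_v by blast
    then show "v !! i = ?u !! i"
      using bonacci_iter_length[OF assms, of i] by (metis nth shift_snth_less)
  qed
qed

definition bonacci_word :: "nat \<Rightarrow> nat stream" where
  "bonacci_word m = (THE u. is_bonacci_word m u)"

lemma is_bonacci_word_bonacci_word: "m \<ge> 2 \<Longrightarrow> is_bonacci_word m (bonacci_word m)"
  unfolding bonacci_word_def by (rule theI'[OF ex1_bonacci_word])

definition is_factor :: "'a list \<Rightarrow> 'a stream \<Rightarrow> bool" where
  "is_factor w u \<longleftrightarrow> (\<exists>i n. w = stake n (sdrop i u))"

(* The counts are compared in int because subtraction on nat truncates. *)
definition balanced_word :: "'a set \<Rightarrow> int \<Rightarrow> 'a stream \<Rightarrow> bool" where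
  "balanced_word A c u \<longleftrightarrow>
     (\<forall>w v. is_factor w u \<longrightarrow> is_factor v u \<longrightarrow> length w = length v \<longrightarrow>
        (\<forall>a\<in>A. int (count_list w a) - int (count_list v a) \<le> c))"

(* At the endpoints x = 0 and x = 2 * pi the integrand is 0 / 0 = 0 in HOL; two points do not affect
   the integral. *)
definition kappa_integrand :: "real \<Rightarrow> real" where
  "kappa_integrand x = (1 - cos x) / ((5 - 4 * cos x) * ln (5 - 4 * cos x))"

lemma kappa_integrand_bounds: "0 \<le> kappa_integrand x" "kappa_integrand x \<le> 1 / 4"
proof -
  define y where "y = 5 - 4 * cos x"
  have y: "y \<ge> 1" using cos_le_one[of x] by (simp add: y_def)
  have c: "1 - cos x = (y - 1) / 4" by (simp add: y_def)
  have eq: "kappa_integrand x = (y - 1) / 4 / (y * ln y)"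
    unfolding kappa_integrand_def c by (simp add: y_def)
  show "0 \<le> kappa_integrand x" using y by (simp add: eq)
  have "ln (1 / y) \<le> 1 / y - 1" using y by (intro ln_le_minus_one) auto
  then have "ln y \<ge> 1 - 1 / y" using y by (simp add: ln_div)
  then have "y * ln y \<ge> y * (1 - 1 / y)" using y by (intro mult_left_mono) auto
  then have *: "y * ln y \<ge> y - 1" using y by (simp add: algebra_simps)
  show "kappa_integrand x \<le> 1 / 4"
  proof (cases "y = 1")
    case False
    then have "y * ln y > 0" using y by simp
    then show ?thesis using * by (simp add: eq divide_simps)
  qed (simp add: eq)
qed

(* The Henstock-Kurzweil integral defaults to 0 on a non-integrable function; this is not the case
   here. *)
lemma kappa_integrand_integrable: "kappa_integrand integrable_on {0..2 * pi}"
proof -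
  have "kappa_integrand \<in> borel_measurable lborel"
    unfolding kappa_integrand_def by measurable
  moreover have "norm (kappa_integrand x) \<le> 1 / 4" for x
    using kappa_integrand_bounds[of x] by simp
  ultimately have "set_integrable lborel {0..2 * pi} kappa_integrand"
    unfolding set_integrable_def
    by (intro integrableI_bounded_set_indicator[where B = "1 / 4"]) auto
  then show ?thesis by (rule set_borel_integral_eq_integral(1))
qed

definition kappa :: real where
  "kappa = 2 / pi * integral {0..2 * pi} kappa_integrand"

end

theory Submission
  imports Defs
begin

(* The prefix of length n of the word is, up to the order of letters, a product of distinct words
   phi^i(0), so the number of occurrences of a in it differs from its expected value by a sum of
   deviations dev a i over a finite set of i, and the imbalance is at most 2 * (SUM i. |dev a i|).
   With eta = beta^(-m) the deviations for the letter 0 are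
     dev 0 i = (D(i - m) - eta * D(i)) / (2 * beta) for i >= 1,  where D(j) = green j - green (j + 1)
   and green is the Green function of the walk on the integers with steps m and -1 of probability
   1/2 each.  Those for the other letters reduce to the letter 0 by desubstitution.

   The sum of |D| is estimated by duality with bounded functions h whose drift
   h x - (h (x + m) + h (x - 1)) / 2 is at most 1 in absolute value: it suffices to bound the increments of h.
   Two walkers at x and x + (m + 1) s that use opposite coins change s by -1 or 1, so for the largest
   difference c s of h at such pairs c s + 2 s^2 is convex, and c 1 is about m + 2 c(m div 2) / m at most.
   Letting one walker alone toss m + 1 coins brings s = m div 2 back to size sqrt m on average.  Together these give c 1 <= m + O(sqrt m),
   hence a balance constant m / 2 + O(sqrt m), and kappa > 1/2 leaves room for the rest. *)

section \<open>Gradient bound for almost harmonic functions of the walk\<close>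

lemma sum_choose_Suc_mult:
  fixes f :: "nat \<Rightarrow> 'a::comm_semiring_1"
  shows "(\<Sum>j\<le>Suc n. of_nat (Suc n choose j) * f j) = (\<Sum>j\<le>n. of_nat (n choose j) * (f j + f (Suc j)))"
proof -
  have "(\<Sum>j\<le>Suc n. of_nat (Suc n choose j) * f j)
      = f 0 + (\<Sum>j\<le>n. of_nat ((n choose Suc j) + (n choose j)) * f (Suc j))"
    by (subst sum.atMost_Suc_shift) (simp add: add.commute)
  also have "\<dots> = (f 0 + (\<Sum>j\<le>n. of_nat (n choose Suc j) * f (Suc j))) + (\<Sum>j\<le>n. of_nat (n choose j) * f (Suc j))"
    by (simp add: distrib_right sum.distrib add.assoc)
  also have "f 0 + (\<Sum>j\<le>n. of_nat (n choose Suc j) * f (Suc j)) = (\<Sum>j\<le>Suc n. of_nat (n choose j) * f j)"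
    by (subst sum.atMost_Suc_shift) simp
  also have "\<dots> = (\<Sum>j\<le>n. of_nat (n choose j) * f j)" by (simp add: binomial_eq_0)
  finally show ?thesis by (simp add: distrib_left sum.distrib)
qed

text \<open>Variance n/4 plus the squared distance of \<open>c\<close> from the mean n/2. The
  induction needs all \<open>c\<close> at once, because Pascal's rule trades one toss for a shift of
  \<open>c\<close> by 1.\<close>

lemma binomial_second_moment:
  fixes c :: real
  shows "(\<Sum>j\<le>n. real (n choose j) * (c - real j)\<^sup>2) = 2 ^ n * (real n / 4 + (c - real n / 2)\<^sup>2)"
proof (induction n arbitrary: c)
  case (Suc n)
  have "(\<Sum>j\<le>Suc n. real (Suc n choose j) * (c - real j)\<^sup>2)
      = (\<Sum>j\<le>n. real (n choose j) * (c - real j)\<^sup>2) + (\<Sum>j\<le>n. real (n choose j) * ((c - 1) - real j)\<^sup>2)"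
    unfolding sum_choose_Suc_mult by (simp add: distrib_left sum.distrib algebra_simps)
  also have "\<dots> = 2 ^ Suc n * (real (Suc n) / 4 + (c - real (Suc n) / 2)\<^sup>2)"
    unfolding Suc.IH by (simp add: power2_eq_square field_simps)
  finally show ?case .
qed simp

text \<open>Cauchy-Schwarz, with the square root \<open>w\<close> of each binomial probability in
  both factors.\<close>

lemma binomial_mean_abs_deviation:
  fixes c :: real
  shows "(\<Sum>j\<le>n. real (n choose j) / 2 ^ n * \<bar>c - real j\<bar>) \<le> sqrt (real n / 4 + (c - real n / 2)\<^sup>2)"
proof -
  define w where "w j = sqrt (real (n choose j) / 2 ^ n)" for j
  have w2: "w j * w j = real (n choose j) / 2 ^ n" for j
    by (simp add: w_def)
  have "(\<Sum>j\<le>n. w j * (w j * \<bar>c - real j\<bar>))\<^sup>2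
      \<le> (\<Sum>j\<le>n. (w j)\<^sup>2) * (\<Sum>j\<le>n. (w j * \<bar>c - real j\<bar>)\<^sup>2)"
    by (rule Cauchy_Schwarz_ineq_sum)
  also have "(\<Sum>j\<le>n. (w j)\<^sup>2) = 1"
  proof -
    have "(\<Sum>j\<le>n. real (n choose j)) = 2 ^ n"
      by (metis choose_row_sum of_nat_sum of_nat_numeral of_nat_power)
    then show ?thesis by (simp add: power2_eq_square w2 flip: sum_divide_distrib)
  qed
  also have "(\<Sum>j\<le>n. (w j * \<bar>c - real j\<bar>)\<^sup>2) = (\<Sum>j\<le>n. real (n choose j) * (c - real j)\<^sup>2) / 2 ^ n"
    by (simp add: power_mult_distrib w2[folded power2_eq_square] sum_divide_distrib)
  also have "\<dots> = real n / 4 + (c - real n / 2)\<^sup>2"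
    by (simp add: binomial_second_moment)
  finally have "(\<Sum>j\<le>n. w j * (w j * \<bar>c - real j\<bar>)) \<le> sqrt (real n / 4 + (c - real n / 2)\<^sup>2)"
    by (intro real_le_rsqrt) simp
  then show ?thesis by (simp add: mult.assoc[symmetric] w2)
qed

text \<open>Each of the k steps costs at most 1; j jumps by m and k - j jumps by -1 lead to x + (m +
  1) j - k.\<close>

lemma walk_iterate:
  fixes h :: "int \<Rightarrow> real" and m :: nat
  assumes step: "\<And>x. \<bar>h x - (h (x + int m) + h (x - 1)) / 2\<bar> \<le> 1"
  shows "\<bar>h x - (\<Sum>j\<le>k. real (k choose j) / 2 ^ k * h (x + (int m + 1) * int j - int k))\<bar> \<le> real k"
proof (induction k arbitrary: x)
  case (Suc k)
  define S where "S y = (\<Sum>j\<le>k. real (k choose j) / 2 ^ k * h (y + (int m + 1) * int j - int k))" for y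
  have "(\<Sum>j\<le>Suc k. real (Suc k choose j) * (h (x + (int m + 1) * int j - int (Suc k)) / 2 ^ Suc k))
     = (S (x + int m) + S (x - 1)) / 2"
    unfolding sum_choose_Suc_mult S_def
    by (simp add: distrib_left sum.distrib algebra_simps add_divide_distrib sum_divide_distrib)
  then have eq: "(\<Sum>j\<le>Suc k. real (Suc k choose j) / 2 ^ Suc k * h (x + (int m + 1) * int j - int (Suc k)))
     = (S (x + int m) + S (x - 1)) / 2"
    by (simp only: times_divide_eq_left times_divide_eq_right)
  have "\<bar>h (x + int m) - S (x + int m)\<bar> \<le> real k" "\<bar>h (x - 1) - S (x - 1)\<bar> \<le> real k"
    using Suc.IH unfolding S_def by auto
  with step[of x] show ?case unfolding eq by (auto simp: abs_le_iff field_simps)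
qed simp

text \<open>\<open>bdd\<close> makes the suprema \<open>c\<close> finite. \<open>M\<close> does not
  enter the bound, so a crude \<open>M\<close> suffices in applications.\<close>

lemma walk_gradient_bound:
  fixes h :: "int \<Rightarrow> real" and m N :: nat
  assumes step: "\<And>x. \<bar>h x - (h (x + int m) + h (x - 1)) / 2\<bar> \<le> 1"
    and bdd: "\<And>x. \<bar>h x\<bar> \<le> M"
    and N: "N = m div 2" and m: "m \<ge> 5"
  shows "\<bar>h x - h (x + 1)\<bar> \<le> 1 + (2 * real N * (real N - 1) + real m + 1) / (real N - sqrt (real m + 2) / 2) / 2"
proof -
  define c where "c s = (SUP x. \<bar>h x - h (x + (int m + 1) * int s)\<bar>)" for s :: nat
  have bdd_c: "bdd_above (range (\<lambda>x. \<bar>h x - h (x + (int m + 1) * int s)\<bar>))" for s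
    by (rule bdd_aboveI2[of _ _ "2 * M"]) (smt (verit) bdd)
  have le_c: "\<bar>h x - h (x + (int m + 1) * int s)\<bar> \<le> c s" for x s
    unfolding c_def by (intro cSUP_upper bdd_c) simp
  have le_c': "\<bar>h x - h y\<bar> \<le> c s" if "\<bar>y - x\<bar> = (int m + 1) * int s" for x y s
  proof -
    have "y = x + (int m + 1) * int s \<or> x = y + (int m + 1) * int s" using that by linarith
    then show ?thesis using le_c[of x s] le_c[of y s] by (metis abs_minus_commute)
  qed
  have c_le: "c s \<le> b" if "\<And>x. \<bar>h x - h (x + (int m + 1) * int s)\<bar> \<le> b" for s b
    unfolding c_def by (intro cSUP_least that) simp
  have c0: "c 0 = 0" unfolding c_def by simp
  have c_nonneg: "0 \<le> c s" for s using le_c[of 0 s] by linarith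
  (* Opposite coins for the two walkers. *)
  have mirror: "2 * c (Suc s) \<le> 4 + c s + c (Suc (Suc s))" for s
  proof -
    have "c (Suc s) \<le> 2 + (c s + c (Suc (Suc s))) / 2"
    proof (rule c_le)
      fix x :: int
      let ?y = "x + (int m + 1) * int (Suc s)"
      have "\<bar>h (x + int m) - h (?y - 1)\<bar> \<le> c s" "\<bar>h (x - 1) - h (?y + int m)\<bar> \<le> c (Suc (Suc s))"
        by (auto intro!: le_c' simp: algebra_simps)
      with step[of x] step[of ?y] show "\<bar>h x - h ?y\<bar> \<le> 2 + (c s + c (Suc (Suc s))) / 2"
        unfolding abs_le_iff by (simp add: field_simps del: of_nat_Suc)
    qed
    then show ?thesis by (simp add: field_simps)
  qed
  \<comment> \<open>By \<open>mirror\<close> the increments of \<open>c\<close>, the first of which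
    is \<open>c 1\<close>, fall by at most 4 at each step. Summed up they give
    \<open>lower\<close>.\<close>
  have diff: "c (Suc s) - c s + 4 * real s \<ge> c 1" for s
  proof (induction s)
    case (Suc s)
    with mirror[of s] show ?case by (simp del: One_nat_def)
  qed (simp add: c0)
  have lower: "c s + 2 * real s * (real s - 1) \<ge> real s * c 1" for s
  proof (induction s)
    case (Suc s)
    with diff[of s] show ?case by (simp add: algebra_simps)
  qed (simp add: c0)
  have lin: "c s \<le> real s * c 1" for s
  proof (induction s)
    case (Suc s)
    have "c (Suc s) \<le> c s + c 1"
    proof (rule c_le)
      fix x :: int
      let ?z = "x + (int m + 1) * int s"
      have "\<bar>h x - h ?z\<bar> \<le> c s" "\<bar>h ?z - h (x + (int m + 1) * int (Suc s))\<bar> \<le> c 1"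
        by (auto intro!: le_c' simp: algebra_simps)
      then show "\<bar>h x - h (x + (int m + 1) * int (Suc s))\<bar> \<le> c s + c 1" by linarith
    qed
    with Suc show ?case by (simp add: algebra_simps)
  qed (simp add: c0)
  \<comment> \<open>After m + 1 steps, j of them upward, the walker from x is at x + (m + 1) (j -
    1). Its distance from x + (m + 1) N is |N + 1 - j| multiples of m + 1, and \<open>E\<close> is
    the mean of this number.\<close>
  define E where "E = (\<Sum>j\<le>m + 1. real (m + 1 choose j) / 2 ^ (m + 1) * \<bar>(real N + 1) - real j\<bar>)"
  (* Only the walker at x moves. *)
  have "c N \<le> real m + 1 + E * c 1"
  proof (rule c_le)
    fix x :: int
    let ?y = "x + (int m + 1) * int N"
    let ?w = "\<lambda>j. real (m + 1 choose j) / 2 ^ (m + 1)"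
    let ?g = "\<lambda>j. x + (int m + 1) * int j - int (m + 1)"
    have w1: "(\<Sum>j\<le>m + 1. ?w j) = 1"
      unfolding sum_divide_distrib[symmetric] of_nat_sum[symmetric] choose_row_sum by simp
    have "\<bar>(\<Sum>j\<le>m + 1. ?w j * h (?g j)) - h ?y\<bar> = \<bar>\<Sum>j\<le>m + 1. ?w j * (h (?g j) - h ?y)\<bar>"
      unfolding right_diff_distrib sum_subtractf sum_distrib_right[symmetric] w1 by simp
    also have "\<dots> \<le> (\<Sum>j\<le>m + 1. \<bar>?w j * (h (?g j) - h ?y)\<bar>)" by (rule sum_abs)
    also have "\<dots> \<le> (\<Sum>j\<le>m + 1. ?w j * (\<bar>real N + 1 - real j\<bar> * c 1))"
    proof (rule sum_mono)
      fix j
      define s where "s = nat \<bar>int N + 1 - int j\<bar>"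
      have "?y - ?g j = (int m + 1) * (int N + 1 - int j)" by (simp add: algebra_simps)
      then have "\<bar>h (?g j) - h ?y\<bar> \<le> c s"
        by (intro le_c') (simp add: abs_mult s_def)
      also have "\<dots> \<le> real s * c 1" by (rule lin)
      also have "real s = \<bar>real N + 1 - real j\<bar>" by (simp add: s_def)
      finally show "\<bar>?w j * (h (?g j) - h ?y)\<bar> \<le> ?w j * (\<bar>real N + 1 - real j\<bar> * c 1)"
        unfolding abs_mult by (intro mult_mono) auto
    qed
    also have "\<dots> = E * c 1" unfolding E_def by (simp only: sum_distrib_right mult.assoc)
    finally have "\<bar>(\<Sum>j\<le>m + 1. ?w j * h (?g j)) - h ?y\<bar> \<le> E * c 1" .
    moreover have "\<bar>h x - (\<Sum>j\<le>m + 1. ?w j * h (?g j))\<bar> \<le> real (m + 1)"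
      by (rule walk_iterate) (rule step)
    ultimately show "\<bar>h x - h ?y\<bar> \<le> real m + 1 + E * c 1" by simp
  qed
  moreover have "E \<le> sqrt (real m + 2) / 2"
  proof -
    have "E \<le> sqrt (real (m + 1) / 4 + (real N + 1 - real (m + 1) / 2)\<^sup>2)"
      unfolding E_def by (rule binomial_mean_abs_deviation)
    also have "\<dots> \<le> sqrt ((real m + 2) / 4)"
    proof (rule real_sqrt_le_mono)
      \<comment> \<open>The mean of j is (m + 1) / 2, and N + 1 is within 1/2 of it; the bias adds
        at most 1/4 to the variance (m + 1) / 4.\<close>
      have "real N + 1 - real (m + 1) / 2 = (if even m then 1 / 2 else 0)"
        unfolding N by (auto elim!: evenE oddE simp: field_simps)
      then show "real (m + 1) / 4 + (real N + 1 - real (m + 1) / 2)\<^sup>2 \<le> (real m + 2) / 4"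
        by (simp add: power2_eq_square)
    qed
    finally show ?thesis by (simp add: real_sqrt_divide)
  qed
  ultimately have "c N \<le> real m + 1 + sqrt (real m + 2) / 2 * c 1"
    using mult_right_mono[OF _ c_nonneg[of 1]] by (smt (verit))
  with lower[of N] have *: "(real N - sqrt (real m + 2) / 2) * c 1 \<le> 2 * real N * (real N - 1) + real m + 1"
    by (simp add: algebra_simps)
  \<comment> \<open>Since 2 N \<ge> m - 1, this makes the coefficient of \<open>c 1\<close> in
    \<open>*\<close> positive.\<close>
  have "sqrt (real m + 2) < real m - 1"
  proof (rule real_less_lsqrt)
    have "5 * real m \<le> real m * real m" using m by (intro mult_right_mono) auto
    moreover have "real m \<ge> 5" using m by simp
    ultimately have "1 + 3 * real m < real m * real m" by linarith
    then show "real m + 2 < (real m - 1)\<^sup>2" by (simp add: power2_eq_square algebra_simps)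
  qed (use m in auto)
  moreover have "2 * real N \<ge> real m - 1" unfolding N by linarith
  ultimately have "real N - sqrt (real m + 2) / 2 > 0" by simp
  then have c1: "c 1 \<le> (2 * real N * (real N - 1) + real m + 1) / (real N - sqrt (real m + 2) / 2)"
    using * by (simp add: pos_le_divide_eq mult.commute)
  \<comment> \<open>From x + 1 the walk moves to x + 1 + m or to x, so up to an error of 1 the
    difference of h at x and x + 1 is half of that at x and x + 1 + m.\<close>
  have "\<bar>h x - h (x + 1 + int m)\<bar> \<le> c 1" by (rule le_c') simp
  moreover have "\<bar>h (x + 1) - (h (x + 1 + int m) + h x) / 2\<bar> \<le> 1"
    using step[of "x + 1"] by simp
  ultimately have "\<bar>h x - h (x + 1)\<bar> \<le> 1 + c 1 / 2"
    unfolding abs_le_iff by (simp add: field_simps del: One_nat_def)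
  with divide_right_mono[OF c1, of 2] show ?thesis by linarith
qed

text \<open>The slope is twice the 52/100 of \<open>kappa_lower\<close>. In q = sqrt (m + 2) / 2
  both m and N are quadratic polynomials (N one for each parity), so clearing the denominator leaves
  a quartic inequality in q.\<close>

lemma gradient_bound_linear:
  fixes m N :: nat
  assumes m: "m \<ge> 5" and N: "N = m div 2"
  shows "(2 * real N * (real N - 1) + real m + 1) / (real N - sqrt (real m + 2) / 2) \<le> 104 / 100 * real m + 10"
proof -
  define q where "q = sqrt (real m + 2) / 2"
  have q2: "q * q = (real m + 2) / 4" by (simp add: q_def)
  have q_ge: "q \<ge> l" if "real m + 2 \<ge> (2 * l)\<^sup>2" "l \<ge> 0" for l
    using real_le_rsqrt[OF that(1)] by (simp add: q_def)
  have quad: "A * (q * q) - 792 / 100 * q \<ge> (A * l - 792 / 100) * l"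
    if "q \<ge> l" "A * l \<ge> 792 / 100" "l \<ge> 0" "A \<ge> 0" for A l
  proof -
    have "(A * l - 792 / 100) * l \<le> (A * q - 792 / 100) * q"
      using that mult_left_mono[OF that(1,4)] by (intro mult_mono) auto
    then show ?thesis by (simp add: algebra_simps)
  qed
  \<comment> \<open>The two leading terms of the quartic completed to a square; a quadratic in q
    remains.\<close>
  define Y where "Y = 32 / 100 * (q * q) * (q - 13 / 2)\<^sup>2"
  have quartic: "Y = 32 / 100 * q ^ 4 - 416 / 100 * q ^ 3 + 1352 / 100 * (q * q)"
    by (simp add: Y_def eval_nat_numeral field_simps)
  \<comment> \<open>Above 215/100 the remaining quadratic is positive by itself. Below, q is far
    enough from 13/2 for \<open>Y\<close> to contribute 6 q^2.\<close>
  have small: "Y \<ge> 6 * (q * q)" if "q \<le> 215 / 100"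
  proof -
    have "(435 / 100)\<^sup>2 \<le> (13 / 2 - q)\<^sup>2" using that by (intro power_mono) auto
    then have "32 / 100 * (q * q) * (q - 13 / 2)\<^sup>2 \<ge> 32 / 100 * (q * q) * (435 / 100)\<^sup>2"
      by (intro mult_left_mono) (auto simp: power2_commute)
    then show ?thesis unfolding Y_def
      by (simp add: power2_eq_square) (use zero_le_square[of q] in linarith)
  qed
  have large: "Y \<ge> 0" by (simp add: Y_def)
  have q: "q \<ge> 13 / 10" using m by (intro q_ge) (auto simp: power2_eq_square)
  have "2 * real N * (real N - 1) + real m + 1 \<le> (104 / 100 * real m + 10) * (real N - q) \<and> real N - q > 0"
  proof (cases "even m")
    case True
    then have m2: "real m = 2 * real N" unfolding N by (auto elim!: evenE)
    then have N': "real N = 2 * (q * q) - 1" using q2 by simp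
    have "m \<ge> 6" using m True by (cases "m = 5") auto
    then have q': "q \<ge> 141 / 100" by (intro q_ge) (auto simp: power2_eq_square)
    have "Y + 616 / 100 * (q * q) - 792 / 100 * q - 1092 / 100 \<ge> 0"
    proof (cases "q \<le> 215 / 100")
      case True
      with small quad[OF q', of "1216 / 100"] show ?thesis by simp
    next
      case False
      then have "616 / 100 * (q * q) - 792 / 100 * q \<ge> (616 / 100 * (215 / 100) - 792 / 100) * (215 / 100)"
        by (intro quad) auto
      with large show ?thesis by simp
    qed
    moreover have "q * q \<ge> 141 / 100 * q" using q' by (intro mult_right_mono) auto
    then have "real N - q > 0" using q' unfolding N' by linarith
    moreover have "(104 / 100 * real m + 10) * (real N - q) - (2 * real N * (real N - 1) + real m + 1)
        = Y + 616 / 100 * (q * q) - 792 / 100 * q - 1092 / 100"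
      unfolding m2 N' quartic by (simp add: eval_nat_numeral field_simps)
    ultimately show ?thesis by linarith
  next
    case False
    then have "odd m" and m2: "real m = 2 * real N + 1" unfolding N by (auto elim!: oddE)
    then have N': "real N = 2 * (q * q) - 3 / 2" using q2 by simp
    show ?thesis
    \<comment> \<open>The tight case: the left side is 10, and the bound on q gives 10.032 on the
      right.\<close>
    proof (cases "m = 5")
      case True
      then have "sqrt (real m + 2) \<le> 268 / 100" by (intro real_le_lsqrt) (auto simp: power2_eq_square)
      then have "q \<le> 134 / 100" by (simp add: q_def)
      moreover have "N = 2" using True N by simp
      ultimately show ?thesis using True by simp
    next
      case False
      with \<open>odd m\<close> m have "m \<ge> 7" by presburger
      then have q': "q \<ge> 15 / 10" by (intro q_ge) (auto simp: power2_eq_square)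
      have "Y + 808 / 100 * (q * q) - 792 / 100 * q - 1838 / 100 \<ge> 0"
      proof (cases "q \<le> 215 / 100")
        case True
        with small quad[OF q', of "1408 / 100"] show ?thesis by simp
      next
        case False
        then have "808 / 100 * (q * q) - 792 / 100 * q \<ge> (808 / 100 * (215 / 100) - 792 / 100) * (215 / 100)"
        by (intro quad) auto
      with large show ?thesis by simp
      qed
      moreover have "q * q \<ge> 15 / 10 * q" using q' by (intro mult_right_mono) auto
      then have "real N - q > 0" using q' unfolding N' by linarith
      moreover have "(104 / 100 * real m + 10) * (real N - q) - (2 * real N * (real N - 1) + real m + 1)
          = Y + 808 / 100 * (q * q) - 792 / 100 * q - 1838 / 100"
        unfolding m2 N' quartic by (simp add: eval_nat_numeral field_simps)
      ultimately show ?thesis by linarith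
    qed
  qed
  then show ?thesis by (simp add: pos_divide_le_eq q_def)
qed

section \<open>A lower bound for kappa\<close>

text \<open>The [2/1] Pade approximant of ln at 1. The derivative of the error is (x - 1)^3 / (x (2
  x + 1)^2), which is nonnegative for x \<ge> 1.\<close>

lemma ln_le_Pade:
  fixes v :: real
  assumes "v \<ge> 1"
  shows "ln v \<le> (v - 1) * (v + 5) / (2 * (2 * v + 1))"
proof -
  let ?f = "\<lambda>v::real. (v - 1) * (v + 5) / (2 * (2 * v + 1)) - ln v"
  have "?f 1 \<le> ?f v"
  proof (rule DERIV_nonneg_imp_nondecreasing[OF assms], intro exI conjI)
    fix x :: real assume x: "1 \<le> x"
    have "(?f has_real_derivative
        (((x + 5) + (x - 1)) * (2 * (2 * x + 1)) - (x - 1) * (x + 5) * 4) / ((2 * (2 * x + 1)) * (2 * (2 * x + 1))) - 1 / x) (at x)"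
      using x by (auto intro!: derivative_eq_intros)
    also have "(((x + 5) + (x - 1)) * (2 * (2 * x + 1)) - (x - 1) * (x + 5) * 4) / ((2 * (2 * x + 1)) * (2 * (2 * x + 1))) - 1 / x
        = (x - 1) ^ 3 / (x * (2 * x + 1)\<^sup>2)"
      using x by (simp add: divide_simps) (simp add: power2_eq_square power3_eq_cube algebra_simps)
    finally show "(?f has_real_derivative (x - 1) ^ 3 / (x * (2 * x + 1)\<^sup>2)) (at x)" .
    show "0 \<le> (x - 1) ^ 3 / (x * (2 * x + 1)\<^sup>2)" using x by simp
  qed
  then show ?thesis by simp
qed

(* In y = 5 - 4 cos x the lower bound is a quadratic chosen close to the one that meets
   (y - 1) / (y ln y) at y = 9 and touches it at y = 3. In v = sqrt y it becomes a polynomial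
   inequality on [1,3], certified by its Bernstein coefficients on [1,2] and [2,3]. *)
lemma kappa_integrand_lower:
  assumes "cos x \<noteq> 1"
  shows "kappa_integrand x \<ge> (456 / 1000 - 52 / 1000 * (- 4 * cos x) + 8 / 1000 * (16 * (cos x)\<^sup>2)) / 4"
proof -
  define v where "v = sqrt (5 - 4 * cos x)"
  have c: "- 1 \<le> cos x" "cos x < 1" using assms cos_le_one[of x] cos_ge_minus_one[of x] by linarith+
  then have v2: "v\<^sup>2 = 5 - 4 * cos x" by (simp add: v_def)
  have v: "1 < v" "v \<le> 3"
    using c by (auto simp: v_def intro!: real_less_rsqrt real_le_lsqrt) (use c in linarith)
  have bern: "v\<^sup>2 * (v + 5) * (229 / 250 - 33 / 250 * v\<^sup>2 + v ^ 4 / 125) \<le> (v + 1) * (2 * v + 1)"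
  proof (cases "v \<le> 2")
    case True
    have "125 * ((v + 1) * (2 * v + 1) - v\<^sup>2 * (v + 5) * (229 / 250 - 33 / 250 * v\<^sup>2 + v ^ 4 / 125)) = 156 * (v - 1) ^ 0 * (2 - v) ^ 7 + 854 * (v - 1) ^ 1 * (2 - v) ^ 6 + 1746 * (v - 1) ^ 2 * (2 - v) ^ 5 + 3251/2 * (v - 1) ^ 3 * (2 - v) ^ 4 + 717 * (v - 1) ^ 4 * (2 - v) ^ 3 + 579/2 * (v - 1) ^ 5 * (2 - v) ^ 2 + 220 * (v - 1) ^ 6 * (2 - v) ^ 1 + 69 * (v - 1) ^ 7 * (2 - v) ^ 0"
      by (simp add: eval_nat_numeral field_simps)
    also have "\<dots> \<ge> 0" using True v by (intro add_nonneg_nonneg mult_nonneg_nonneg zero_le_power) auto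
    finally show ?thesis by simp
  next
    case False
    have "125 * ((v + 1) * (2 * v + 1) - v\<^sup>2 * (v + 5) * (229 / 250 - 33 / 250 * v\<^sup>2 + v ^ 4 / 125)) = 69 * (v - 2) ^ 0 * (3 - v) ^ 7 + 746 * (v - 2) ^ 1 * (3 - v) ^ 6 + 6891/2 * (v - 2) ^ 2 * (3 - v) ^ 5 + 8298 * (v - 2) ^ 3 * (3 - v) ^ 4 + 21819/2 * (v - 2) ^ 4 * (3 - v) ^ 3 + 7527 * (v - 2) ^ 5 * (3 - v) ^ 2 + 2264 * (v - 2) ^ 6 * (3 - v) ^ 1 + 116 * (v - 2) ^ 7 * (3 - v) ^ 0"
      by (simp add: eval_nat_numeral field_simps)
    also have "\<dots> \<ge> 0" using False v by (intro add_nonneg_nonneg mult_nonneg_nonneg zero_le_power) auto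
    finally show ?thesis by simp
  qed
  have pos: "v\<^sup>2 * (v + 5) > 0" using v by simp
  have "(456 / 1000 - 52 / 1000 * (- 4 * cos x) + 8 / 1000 * (16 * (cos x)\<^sup>2)) / 4
      = (229 / 250 - 33 / 250 * v\<^sup>2 + v ^ 4 / 125) / 4"
  proof -
    have "cos x = (5 - v\<^sup>2) / 4" using v2 by simp
    then show ?thesis by (simp only:) (simp add: eval_nat_numeral field_simps)
  qed
  also have "\<dots> \<le> (v + 1) * (2 * v + 1) / (v\<^sup>2 * (v + 5)) / 4"
    using bern pos by (simp add: pos_le_divide_eq mult.commute)
  also have "\<dots> = (v\<^sup>2 - 1) / 4 / (v\<^sup>2 * (2 * ((v - 1) * (v + 5) / (2 * (2 * v + 1)))))"
    using v by (simp add: divide_simps) (simp add: power2_eq_square algebra_simps)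
  also have "\<dots> \<le> (v\<^sup>2 - 1) / 4 / (v\<^sup>2 * (2 * ln v))"
    using v ln_le_Pade[of v] by (intro divide_left_mono mult_left_mono mult_pos_pos) auto
  also have "\<dots> = kappa_integrand x"
  proof -
    have "2 * ln v = ln (v\<^sup>2)" using v by (simp add: ln_realpow)
    moreover have "(v\<^sup>2 - 1) / 4 = 1 - cos x" using v2 by simp
    ultimately show ?thesis unfolding kappa_integrand_def by (simp only: v2)
  qed
  finally show ?thesis .
qed

text \<open>Over a period cos has mean 0 and cos^2 has mean 1/2, so the lower bound
  \<open>?q\<close> has mean (0.456 + 0.008 * 8) / 4 = 0.13, and kappa is 4 times the mean of the
  integrand.\<close>

lemma kappa_lower: "kappa \<ge> 52 / 100"
proof -
  let ?q = "\<lambda>x. (456 / 1000 - 52 / 1000 * (- 4 * cos x) + 8 / 1000 * (16 * (cos x)\<^sup>2)) / (4::real)"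
  let ?Q = "\<lambda>x. 13 / 100 * x + 52 / 1000 * sin x + 16 / 1000 * (sin x * cos x)"
  have "(?q has_integral (?Q (2 * pi) - ?Q 0)) {0..2 * pi}"
  proof (rule fundamental_theorem_of_calculus)
    fix x :: real
    have "(?Q has_real_derivative 13 / 100 + 52 / 1000 * cos x + 16 / 1000 * (cos x * cos x + - sin x * sin x)) (at x)"
      by (auto intro!: derivative_eq_intros)
    also have "- sin x * sin x = (cos x)\<^sup>2 - 1"
      by (simp add: cos_squared_eq flip: power2_eq_square)
    also have "13 / 100 + 52 / 1000 * cos x + 16 / 1000 * (cos x * cos x + ((cos x)\<^sup>2 - 1)) = ?q x"
      by (simp add: power2_eq_square field_simps)
    finally show "(?Q has_vector_derivative ?q x) (at x within {0..2 * pi})"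
      by (simp add: has_real_derivative_iff_has_vector_derivative has_vector_derivative_at_within)
  qed simp
  then have q: "(?q has_integral (26 / 100 * pi)) {0..2 * pi}" by simp
  have "26 / 100 * pi \<le> integral {0..2 * pi} kappa_integrand"
  proof (rule has_integral_le[OF q])
    \<comment> \<open>At the endpoints the integrand is 0 by the convention for division and lies
      below \<open>?q\<close>; changing two points does not affect the integral.\<close>
    let ?g = "\<lambda>x. if x \<in> {0, 2 * pi} then ?q x else kappa_integrand x"
    show "(?g has_integral integral {0..2 * pi} kappa_integrand) {0..2 * pi}"
      by (rule has_integral_spike_finite[OF _ _ integrable_integral[OF kappa_integrand_integrable], of "{0, 2 * pi}"]) auto
    fix x :: real assume x: "x \<in> {0..2 * pi}"
    have "cos x \<noteq> 1" if "x \<noteq> 0" "x \<noteq> 2 * pi"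
    proof
      assume "cos x = 1"
      then obtain n :: int where n: "x = of_int n * 2 * pi" by (auto simp: cos_one_2pi_int)
      have "0 < x" "x < 2 * pi" using x that by auto
      then have "0 < of_int n * (2 * pi)" "of_int n * (2 * pi) < 1 * (2 * pi)"
        unfolding n by (simp_all only: mult.assoc mult_1)
      then have "0 < n" "n < 1"
        by (simp_all only: zero_less_mult_iff mult_less_cancel_right) (simp_all add: not_less)
      then show False by simp
    qed
    then show "?q x \<le> ?g x" using kappa_integrand_lower[of x] by auto
  qed
  then show ?thesis by (simp add: kappa_def field_simps)
qed

section \<open>Prefixes as products of iterated images of 0\<close>

abbreviation bonacci_map :: "nat \<Rightarrow> nat list \<Rightarrow> nat list" where
  "bonacci_map m w \<equiv> concat (map (bonacci_subst m) w)"

lemma count_bonacci_map_0: "count_list (bonacci_map m w) 0 = length w"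
  by (induction w) (auto simp: bonacci_subst_def)

lemma count_bonacci_map_Suc:
  "Suc a < m \<Longrightarrow> count_list (bonacci_map m w) (Suc a) = count_list w a"
  by (induction w) (auto simp: bonacci_subst_def)

lemma length_bonacci_map:
  assumes "set w \<subseteq> {..<m}"
  shows "length (bonacci_map m w) + count_list w (m - 1) = 2 * length w"
  using assms by (induction w) (auto simp: bonacci_subst_def)

text \<open>One sequence for everything: lengths of iterates and counts of the other letters are
  shifts of it, by \<open>length_bonacci_iter\<close> and \<open>count_bonacci_iter\<close>.\<close>

definition bonacci_count :: "nat \<Rightarrow> nat \<Rightarrow> nat" where
  "bonacci_count m i = count_list (bonacci_iter m i) 0"

lemma bonacci_count_0 [simp]: "bonacci_count m 0 = 1"
  by (simp add: bonacci_count_def bonacci_iter_0)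

lemma length_bonacci_iter: "length (bonacci_iter m i) = bonacci_count m (Suc i)"
  by (simp add: bonacci_count_def bonacci_iter_Suc count_bonacci_map_0)

lemma count_bonacci_iter:
  "a < m \<Longrightarrow> count_list (bonacci_iter m i) a = (if a \<le> i then bonacci_count m (i - a) else 0)"
proof (induction i arbitrary: a)
  case 0
  then show ?case by (simp add: bonacci_iter_0)
next
  case (Suc i)
  then show ?case
    by (cases a) (auto simp: bonacci_iter_Suc bonacci_count_def count_bonacci_map_0 count_bonacci_map_Suc)
qed

lemma bonacci_count_1 [simp]: "bonacci_count m (Suc 0) = 1"
  by (simp add: bonacci_iter_0 flip: length_bonacci_iter)

text \<open>Every letter has an image of length 2 except m - 1. This is the m-bonacci recurrence
  after differencing.\<close>

lemma bonacci_count_rec: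
  assumes "m \<ge> 1"
  shows "bonacci_count m (Suc (Suc i)) + (if m \<le> Suc i then bonacci_count m (Suc i - m) else 0)
       = 2 * bonacci_count m (Suc i)"
proof -
  have "length (bonacci_iter m (Suc i)) + count_list (bonacci_iter m i) (m - 1) = 2 * length (bonacci_iter m i)"
    unfolding bonacci_iter_Suc by (rule length_bonacci_map) (rule bonacci_iter_set[OF assms])
  then show ?thesis using assms
    by (auto simp: length_bonacci_iter count_bonacci_iter split: if_splits)
qed

text \<open>A cut falls either between two images of letters or inside an image 0(a+1), just after
  its 0. The strict decrease of the length drives the later induction.\<close>

lemma stake_fixed_point:
  assumes fixp: "flat (smap (bonacci_subst m) u) = u"
  shows "\<exists>n' b. n' \<le> n \<and> (n > 0 \<longrightarrow> n' < n) \<and> stake n u = bonacci_map m (stake n' u) @ (if b then [0] else [])"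
proof (induction n)
  case 0
  have "stake 0 u = bonacci_map m (stake 0 u) @ (if False then [0] else [])" by simp
  then show ?case by blast
next
  case (Suc n)
  then obtain n' b where le: "n' \<le> n" "n > 0 \<longrightarrow> n' < n"
    and eq: "stake n u = bonacci_map m (stake n' u) @ (if b then [0] else [])" by blast
  let ?a = "u !! n'"
  have step: "stake (Suc n') u = stake n' u @ [?a]" by (rule stake_Suc)
  have split: "u = bonacci_map m (stake k u) @- flat (smap (bonacci_subst m) (sdrop k u))" for k
    using flat_smap_shift[of m "stake k u" "sdrop k u"] by (simp only: stake_sdrop fixp)
  have len: "n = length (bonacci_map m (stake n' u)) + (if b then 1 else 0)"
    using arg_cong[OF eq, of length] by simp
  have next0: "u !! length (bonacci_map m (stake k u)) = 0" for k
  proof -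
    have "flat (smap (bonacci_subst m) (sdrop k u)) !! 0 = 0" by (simp add: bonacci_subst_def)
    then show ?thesis by (subst split[of k]) (simp del: snth.simps)
  qed
  show ?case
  proof (cases b)
    case False
    then have "stake (Suc n) u = bonacci_map m (stake n' u) @ (if True then [0] else [])"
      using next0[of n'] len eq by (simp add: stake_Suc del: stake.simps)
    then show ?thesis using le by (intro exI[of _ n'] exI[of _ True]) auto
  next
    case True
    show ?thesis
    \<comment> \<open>The trailing 0 begins the image of \<open>?a\<close>: the next letter either
      completes this image, or the image was 0 alone and the next letter is the 0 of a new
      one.\<close>
    proof (cases "?a + 1 < m")
      case True
      have "length (bonacci_map m (stake (Suc n') u)) = Suc n"
        unfolding step using True len \<open>b\<close> by (simp add: bonacci_subst_def)
      then have "stake (Suc n) u = bonacci_map m (stake (Suc n') u) @ (if False then [0] else [])"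
        using arg_cong[OF split[of "Suc n'"], of "stake (Suc n)"] by (simp add: stake_shift del: stake.simps)
      then show ?thesis using le len \<open>b\<close> by (intro exI[of _ "Suc n'"] exI[of _ False]) auto
    next
      case False
      then have *: "bonacci_map m (stake (Suc n') u) = stake n u"
        unfolding step using eq \<open>b\<close> by (simp add: bonacci_subst_def)
      then have "u !! n = 0" using next0[of "Suc n'"] by (simp del: stake.simps)
      then have "stake (Suc n) u = bonacci_map m (stake (Suc n') u) @ (if True then [0] else [])"
        using * by (simp add: stake_Suc del: stake.simps)
      then show ?thesis using le len \<open>b\<close> by (intro exI[of _ "Suc n'"] exI[of _ True]) auto
    qed
  qed
qed

text \<open>Repeated desubstitution by \<open>stake_fixed_point\<close>: applying the substitution
  raises every index by 1, and a trailing 0 contributes the index 0, which is then still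
  free.\<close>

lemma prefix_count_decomposition:
  assumes u: "is_bonacci_word m u"
  shows "\<exists>I. finite I \<and> n = (\<Sum>i\<in>I. length (bonacci_iter m i))
    \<and> (\<forall>a<m. count_list (stake n u) a = (\<Sum>i\<in>I. count_list (bonacci_iter m i) a))"
proof (induction n rule: less_induct)
  case (less n)
  have fixp: "flat (smap (bonacci_subst m) u) = u" and sub: "sset u \<subseteq> {..<m}"
    using u by (auto simp: is_bonacci_word_def)
  have m: "m > 0" using sub by (cases u) auto
  show ?case
  proof (cases "n = 0")
    case True
    then show ?thesis by (intro exI[of _ "{}"]) simp
  next
    case False
    obtain n' b where "n' < n"
      and eq: "stake n u = bonacci_map m (stake n' u) @ (if b then [0] else [])"
      using stake_fixed_point[OF fixp, of n] False by blast
    obtain I where I: "finite I" "n' = (\<Sum>i\<in>I. length (bonacci_iter m i))"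
      "\<And>a. a < m \<Longrightarrow> count_list (stake n' u) a = (\<Sum>i\<in>I. count_list (bonacci_iter m i) a)"
      using less.IH[OF \<open>n' < n\<close>] by blast
    define J where "J = Suc ` I \<union> (if b then {0} else {})"
    have sum_J: "(\<Sum>i\<in>J. f i) = (\<Sum>i\<in>I. f (Suc i)) + (if b then f 0 else 0)" for f :: "nat \<Rightarrow> nat"
      unfolding J_def using I(1) by (auto simp: sum.reindex add.commute)
    have "finite J" using I(1) by (simp add: J_def)
    moreover have "n = (\<Sum>i\<in>J. length (bonacci_iter m i))"
    proof -
      \<comment> \<open>The length of an image depends only on the length of the word and its count
        of m - 1, and \<open>I\<close> decomposes both.\<close>
      have "set (stake n' u) \<subseteq> {..<m}" using sub by (metis sset_shift stake_sdrop le_sup_iff)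
      from length_bonacci_map[OF this]
      have "length (bonacci_map m (stake n' u)) + (\<Sum>i\<in>I. count_list (bonacci_iter m i) (m - 1)) = 2 * n'"
        using I(3)[of "m - 1"] m by simp
      moreover have "(\<Sum>i\<in>I. length (bonacci_iter m (Suc i))) + (\<Sum>i\<in>I. count_list (bonacci_iter m i) (m - 1)) = 2 * n'"
        unfolding I(2) sum_distrib_left sum.distrib[symmetric] bonacci_iter_Suc
        using m by (intro sum.cong refl length_bonacci_map bonacci_iter_set) simp
      moreover have "n = length (bonacci_map m (stake n' u)) + (if b then 1 else 0)"
        using arg_cong[OF eq, of length] by simp
      ultimately show ?thesis by (simp add: sum_J bonacci_iter_0)
    qed
    moreover have "count_list (stake n u) a = (\<Sum>i\<in>J. count_list (bonacci_iter m i) a)" if "a < m" for a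
    proof (cases a)
      case 0
      then show ?thesis unfolding eq
        by (simp add: sum_J bonacci_iter_0 bonacci_iter_Suc count_bonacci_map_0 I(2))
    next
      case (Suc a')
      with that show ?thesis unfolding eq
        by (simp add: sum_J bonacci_iter_0 bonacci_iter_Suc count_bonacci_map_Suc I(3))
    qed
    ultimately show ?thesis by blast
  qed
qed

section \<open>The Green function and the deviations\<close>

lemma power_19_lower:
  assumes "m \<ge> 5"
  shows "4 * (real m + 1) \<le> (19 / 10) ^ m"
  using assms by (induction m rule: dec_induct) (auto simp: eval_nat_numeral)

text \<open>The characteristic equation of \<open>bonacci_count_rec\<close> also has the root 1; on
  [19/10, 2] the left side falls from above 1 to 0.\<close>

lemma bonacci_root_exists:
  assumes "m \<ge> 5"
  shows "\<exists>\<beta>::real. 19 / 10 \<le> \<beta> \<and> \<beta> < 2 \<and> \<beta> ^ m * (2 - \<beta>) = 1"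
proof -
  have "\<exists>\<beta>\<ge>19 / 10. \<beta> \<le> 2 \<and> \<beta> ^ m * (2 - \<beta>) = (1::real)"
    by (rule IVT2') (use power_19_lower[OF assms] assms in \<open>auto intro!: continuous_intros\<close>)
  then show ?thesis by (metis diff_self less_eq_real_def mult_zero_right zero_neq_one)
qed

text \<open>By \<open>root\<close>, \<open>2 - \<beta>\<close> is the eta = beta^(-m) of the
  overview and stands for it throughout.\<close>

locale bonacci_root =
  fixes m :: nat and \<beta> :: real
  assumes m: "m \<ge> 5" and \<beta>_ge: "19 / 10 \<le> \<beta>" and \<beta>_less: "\<beta> < 2"
    and root: "\<beta> ^ m * (2 - \<beta>) = 1"
begin

definition count_ext :: "int \<Rightarrow> real" where
  "count_ext j = (if j < 0 then 0 else real (bonacci_count m (nat j)))"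

text \<open>The recurrence of \<open>count_ext\<close> is off by 1 at j = -1 and by -1 at j = 0.
  Summation leaves a single unit source at j = 0, as a Green function requires; see
  \<open>count_sum_rec\<close>.\<close>

definition count_sum :: "int \<Rightarrow> real" where
  "count_sum j = (\<Sum>i<nat j. count_ext (int i))"

(* The constant that makes green bounded, see green_rec. *)
definition green_scale :: real where
  "green_scale = 2 / (2 - (real m + 1) * (2 - \<beta>))"

(* Green's function of the walk on the integers that jumps by m or by -1 with probability 1/2 each. *)
definition green :: "int \<Rightarrow> real" where
  "green j = green_scale * \<beta> powi j - 2 * count_sum j"

section \<open>Recurrences and boundedness of the Green function\<close>

lemma eta_small: "(2 - \<beta>) * (4 * (real m + 1)) \<le> 1"
proof -
  have "4 * (real m + 1) \<le> \<beta> ^ m"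
    using power_19_lower[OF m] power_mono[OF \<beta>_ge, of m] by simp
  then have "(2 - \<beta>) * (4 * (real m + 1)) \<le> (2 - \<beta>) * \<beta> ^ m"
    using \<beta>_less by (intro mult_left_mono) auto
  then show ?thesis using root by (simp add: mult.commute)
qed

lemma green_scale_pos: "green_scale > 0"
  using eta_small by (simp add: green_scale_def field_simps)

lemma powi_minus_m: "\<beta> powi (j - int m) = (2 - \<beta>) * \<beta> powi j"
proof -
  have "\<beta> powi j = \<beta> powi (j - int m) * \<beta> ^ m"
    using \<beta>_ge power_int_add[of \<beta> "j - int m" "int m"] by simp
  then have "\<beta> powi j * (2 - \<beta>) = \<beta> powi (j - int m) * (\<beta> ^ m * (2 - \<beta>))"
    by simp
  then show ?thesis by (simp add: root mult.commute)
qed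

lemma powi_Suc: "\<beta> powi (j + 1) = \<beta> * \<beta> powi j"
  using \<beta>_ge by (simp add: power_int_add)

lemma count_ext_0: "count_ext 0 = 1"
  by (simp add: count_ext_def)

lemma count_ext_1: "count_ext 1 = 1"
  by (simp add: count_ext_def)

lemma count_ext_rec: "j \<ge> 1 \<Longrightarrow> count_ext (j + 1) = 2 * count_ext j - count_ext (j - int m)"
proof -
  assume "j \<ge> 1"
  define i where "i = nat (j - 1)"
  have j: "j = int (Suc i)" using \<open>j \<ge> 1\<close> by (simp add: i_def)
  have "real (bonacci_count m (Suc (Suc i))) + (if m \<le> Suc i then real (bonacci_count m (Suc i - m)) else 0)
      = 2 * real (bonacci_count m (Suc i))"
    using arg_cong[OF bonacci_count_rec[of m i], of real] m by (simp split: if_splits)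
  moreover have "nat (j + 1) = Suc (Suc i)" "nat j = Suc i" "nat (j - int m) = Suc i - m" unfolding j by auto
  ultimately show ?thesis unfolding count_ext_def using j by (auto split: if_splits)
qed

lemma count_sum_nonpos: "j \<le> 0 \<Longrightarrow> count_sum j = 0"
  by (simp add: count_sum_def)

lemma count_sum_Suc: "count_sum (j + 1) = count_sum j + count_ext j"
proof (cases "j \<ge> 0")
  case True
  then have "nat (j + 1) = Suc (nat j)" by simp
  then show ?thesis using True by (simp add: count_sum_def)
next
  case False
  then show ?thesis by (simp add: count_sum_nonpos count_ext_def)
qed

lemma count_sum_rec: "count_sum (j + 1) = 2 * count_sum j - count_sum (j - int m) + of_bool (j = 0)"
proof (cases "j \<ge> 0")
  case True
  then show ?thesis
  proof (induction j rule: int_ge_induct)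
    case base
    show ?case using count_sum_Suc[of 0] m by (simp add: count_sum_nonpos count_ext_0)
  next
    case (step j)
    show ?case
    proof (cases "j = 0")
      case True
      have "count_sum 1 = 1" using count_sum_Suc[of 0] by (simp add: count_sum_nonpos count_ext_0)
      moreover have "count_sum 2 = count_sum 1 + 1" using count_sum_Suc[of 1] by (simp add: count_ext_1)
      ultimately show ?thesis using True m by (simp add: count_sum_nonpos)
    next
      case False
      have "count_sum (j + 1 - int m) = count_sum (j - int m) + count_ext (j - int m)"
        using count_sum_Suc[of "j - int m"] by (simp add: algebra_simps)
      then show ?thesis using step False count_ext_rec[of j] count_sum_Suc[of "j + 1"] count_sum_Suc[of j] by simp
    qed
  qed
next
  case False
  then show ?thesis by (simp add: count_sum_nonpos)
qed

text \<open>beta^j is harmonic because beta + beta^(-m) = 2, and the factor -2 turns the source of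
  \<open>count_sum_rec\<close> into a unit mass.\<close>

lemma green_eq: "green j = of_bool (j = 0) + (green (j + 1) + green (j - int m)) / 2"
  unfolding green_def powi_Suc powi_minus_m count_sum_rec[of j] by (simp add: field_simps)

text \<open>Isolates the growing part of the counts as a multiple of beta^j, which cancels in
  \<open>dev_0_Suc\<close>.\<close>

lemma green_diff: "count_ext j = (green j - green (j + 1)) / 2 + green_scale * (\<beta> - 1) / 2 * \<beta> powi j"
  unfolding green_def powi_Suc count_sum_Suc by (simp add: field_simps)

(* The unstable mode beta^j is divided out of the recurrence of green; what remains has
   nonnegative coefficients summing to 1. *)
lemma green_rec: "green (int n + 1) = (\<Sum>k<m. \<beta> ^ k * (2 - \<beta>) * green (int n - int k))"
proof (induction n)
  case 0
  \<comment> \<open>At nonpositive arguments only the geometric term of \<open>green\<close> is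
    present, so all m summands agree; \<open>green_scale\<close> is the solution of the resulting
    linear equation.\<close>
  have "(\<Sum>k<m. \<beta> ^ k * (2 - \<beta>) * green (- int k)) = (\<Sum>k<m. (2 - \<beta>) * green_scale)"
    using \<beta>_ge by (intro sum.cong refl) (simp add: green_def count_sum_nonpos power_int_minus)
  also have "\<dots> = real m * (2 - \<beta>) * green_scale" by simp
  also have "\<dots> = green_scale * \<beta> - 2"
  proof -
    have "green_scale * (2 - (real m + 1) * (2 - \<beta>)) = 2"
      using eta_small by (simp add: green_scale_def field_simps)
    then show ?thesis by (simp add: algebra_simps)
  qed
  also have "\<dots> = green 1" using count_sum_Suc[of 0] by (simp add: green_def count_sum_nonpos count_ext_0)
  finally show ?case by simp
next
  case (Suc n)
  obtain m' where m': "m = Suc m'" using m by (cases m) auto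
  have first: "(\<Sum>k<m. f k) = f 0 + (\<Sum>k<m'. f (Suc k))"
    and last: "(\<Sum>k<m. f k) = (\<Sum>k<m'. f k) + f m'" for f :: "nat \<Rightarrow> real"
    using m' sum.lessThan_Suc_shift[of f m'] by auto
  let ?S = "\<Sum>k<m'. \<beta> ^ k * (2 - \<beta>) * green (int n - int k)"
  \<comment> \<open>The weight of k + 1 is \<open>\<beta>\<close> times that of k, and the term
    leaving the window has coefficient \<open>\<beta> ^ m * (2 - \<beta>)\<close>, that is,
    1.\<close>
  have "(\<Sum>k<m. \<beta> ^ k * (2 - \<beta>) * green (int (Suc n) - int k)) = (2 - \<beta>) * green (int n + 1) + \<beta> * ?S"
    unfolding first by (simp add: sum_distrib_left mult_ac add.commute)
  also have "\<beta> * ?S = \<beta> * green (int n + 1) - (\<beta> ^ m * (2 - \<beta>)) * green (int n + 1 - int m)"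
  proof -
    have S: "?S = green (int n + 1) - \<beta> ^ m' * (2 - \<beta>) * green (int n - int m')"
      unfolding Suc.IH last by simp
    have idx: "int n + 1 - int m = int n - int m'" "\<beta> ^ m = \<beta> * \<beta> ^ m'" unfolding m' by auto
    show ?thesis unfolding S idx by (simp add: right_diff_distrib[of \<beta>] mult.assoc)
  qed
  also have "(2 - \<beta>) * green (int n + 1) + \<dots> = 2 * green (int n + 1) - green (int n + 1 - int m)"
    unfolding root by (simp add: algebra_simps)
  also have "\<dots> = green (int (Suc n) + 1)"
    using green_eq[of "int n + 1"] by (simp add: algebra_simps)
  finally show ?case by simp
qed

lemma green_bounds_nonpos: "j \<le> 0 \<Longrightarrow> 0 \<le> green j \<and> green j \<le> green_scale"
proof -
  assume j: "j \<le> 0"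
  then have "\<beta> powi j \<le> \<beta> powi 0" using \<beta>_ge by (intro power_int_increasing) auto
  moreover have "\<beta> powi j \<ge> 0" using \<beta>_ge by (intro zero_le_power_int) auto
  ultimately show ?thesis using j green_scale_pos by (simp add: green_def count_sum_nonpos)
qed

text \<open>By \<open>green_rec\<close> each value at a positive argument is a weighted mean of the
  m values before it, so the bounds at nonpositive arguments propagate.\<close>

lemma green_bounds: "0 \<le> green j \<and> green j \<le> green_scale"
proof (cases "j \<le> 0")
  case False
  have w: "(\<Sum>k<m. \<beta> ^ k * (2 - \<beta>)) = 1"
  proof -
    have "(\<Sum>k<m. \<beta> ^ k) * (\<beta> - 1) = \<beta> ^ m - 1"
      using power_diff_1_eq[of \<beta> m] by (simp add: mult.commute)
    then have "(\<Sum>k<m. \<beta> ^ k) * (\<beta> - 1) * (2 - \<beta>) = \<beta> ^ m * (2 - \<beta>) - (2 - \<beta>)"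
      by (simp only: left_diff_distrib mult_1)
    then have "(\<Sum>k<m. \<beta> ^ k) * (\<beta> - 1) * (2 - \<beta>) = \<beta> - 1"
      unfolding root by simp
    then show ?thesis using \<beta>_ge by (simp add: sum_distrib_right[symmetric] mult.assoc mult.left_commute)
  qed
  have "0 \<le> green (int n) \<and> green (int n) \<le> green_scale" for n
  proof (induction n rule: less_induct)
    case (less n)
    show ?case
    proof (cases n)
      case 0
      then show ?thesis using green_bounds_nonpos[of 0] by simp
    next
      case (Suc n')
      have b: "0 \<le> green (int n' - int k)" "green (int n' - int k) \<le> green_scale" for k
        using less.IH[of "n' - k"] green_bounds_nonpos[of "int n' - int k"] Suc
        by (cases "k \<le> n'"; simp add: of_nat_diff)+
      have eq: "green (int n) = (\<Sum>k<m. \<beta> ^ k * (2 - \<beta>) * green (int n' - int k))"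
        using green_rec[of n'] Suc by (simp add: add.commute)
      have "(\<Sum>k<m. \<beta> ^ k * (2 - \<beta>) * green (int n' - int k)) \<ge> 0"
        using \<beta>_ge \<beta>_less b by (intro sum_nonneg mult_nonneg_nonneg) auto
      moreover have "(\<Sum>k<m. \<beta> ^ k * (2 - \<beta>) * green (int n' - int k)) \<le> (\<Sum>k<m. \<beta> ^ k * (2 - \<beta>) * green_scale)"
        using \<beta>_ge \<beta>_less b by (intro sum_mono mult_left_mono) auto
      moreover have "\<dots> = green_scale" using w by (simp flip: sum_distrib_right)
      ultimately show ?thesis unfolding eq by simp
    qed
  qed
  from this[of "nat j"] False show ?thesis by simp
qed (rule green_bounds_nonpos)

definition gradient_bound :: real where
  "gradient_bound = 1 + (2 * real (m div 2) * (real (m div 2) - 1) + real m + 1) / (real (m div 2) - sqrt (real m + 2) / 2) / 2"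

(* The sum of the absolute values is a difference h 0 - h (-1) of the bounded potential h of the signs. *)
lemma green_variation:
  assumes "finite F"
  shows "(\<Sum>i\<in>F. \<bar>green i - green (i + 1)\<bar>) \<le> gradient_bound"
proof -
  define s where "s i = sgn (green i - green (i + 1))" for i
  define h where "h x = (\<Sum>i\<in>F. s i * green (i - x))" for x
  have "\<bar>h (- 1) - h (- 1 + 1)\<bar> \<le> gradient_bound"
    unfolding gradient_bound_def
  proof (rule walk_gradient_bound[OF _ _ refl m])
    show "\<bar>h x\<bar> \<le> (\<Sum>i\<in>F. green_scale)" for x
      unfolding h_def using green_bounds
      by (intro order.trans[OF sum_abs] sum_mono) (simp add: s_def abs_mult abs_sgn_eq green_scale_pos less_imp_le)
    show "\<bar>h x - (h (x + int m) + h (x - 1)) / 2\<bar> \<le> 1" for x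
    proof -
      \<comment> \<open>The drift of the potential recovers its charge: by \<open>green_eq\<close>
        only the index i = x survives.\<close>
      have "h x - (h (x + int m) + h (x - 1)) / 2
          = (\<Sum>i\<in>F. s i * (green (i - x) - (green (i - x + 1) + green (i - x - int m)) / 2))"
        by (simp add: h_def algebra_simps sum.distrib sum_subtractf sum_divide_distrib add_divide_distrib)
      also have "\<dots> = (\<Sum>i\<in>F. s i * of_bool (i = x))"
      proof (rule sum.cong)
        fix i
        show "s i * (green (i - x) - (green (i - x + 1) + green (i - x - int m)) / 2) = s i * of_bool (i = x)"
          using green_eq[of "i - x"] by simp
      qed simp
      also have "\<dots> = (if x \<in> F then s x else 0)"
        using assms by (simp add: of_bool_def if_distrib sum.delta cong: if_cong)
      finally show ?thesis by (simp add: s_def abs_sgn_eq)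
    qed
  qed
  moreover have "h 0 - h (- 1) = (\<Sum>i\<in>F. \<bar>green i - green (i + 1)\<bar>)"
    unfolding h_def sum_subtractf[symmetric] s_def
    by (intro sum.cong refl) (simp add: abs_sgn left_diff_distrib mult.commute)
  ultimately show ?thesis by simp
qed

(* The deviation of the image of 0 under the i-th power of the substitution from the frequency
   of the letter a. *)
definition dev :: "nat \<Rightarrow> nat \<Rightarrow> real" where
  "dev a i = count_ext (int i - int a) - count_ext (int i + 1) / \<beta> ^ Suc a"

text \<open>With j = i + 1, \<open>count_ext_rec\<close> rewrites the deviation as (c(j - m) - (2 -
  beta) c(j)) / beta for c = \<open>count_ext\<close>; the geometric terms of
  \<open>green_diff\<close> cancel by \<open>powi_minus_m\<close>. The recurrence requires j \<ge>
  1, hence \<open>Suc\<close>.\<close>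

lemma dev_0_Suc: "dev 0 (Suc i) = ((green (int (Suc i) - int m) - green (int (Suc i) - int m + 1))
    - (2 - \<beta>) * (green (int (Suc i)) - green (int (Suc i) + 1))) / (2 * \<beta>)"
proof -
  let ?j = "int (Suc i)"
  have "count_ext (?j - int m) - (2 - \<beta>) * count_ext ?j = ((green (?j - int m) - green (?j - int m + 1))
    - (2 - \<beta>) * (green ?j - green (?j + 1))) / 2"
    unfolding green_diff[of "?j - int m"] green_diff[of ?j] powi_minus_m by (simp add: field_simps)
  moreover have "dev 0 (Suc i) = (count_ext (?j - int m) - (2 - \<beta>) * count_ext ?j) / \<beta>"
    using count_ext_rec[of ?j] \<beta>_ge by (simp add: dev_def field_simps)
  ultimately show ?thesis by (simp only: divide_divide_eq_left)
qed

section \<open>Absolute sums of deviations and the discrepancy of prefixes\<close>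

definition dev0_bound :: real where
  "dev0_bound = 1 - 1 / \<beta> + (3 - \<beta>) * gradient_bound / (2 * \<beta>)"

lemma sum_dev_0: "(\<Sum>i<K. \<bar>dev 0 i\<bar>) \<le> dev0_bound"
proof (cases K)
  case 0
  have "0 \<le> gradient_bound" using green_variation[of "{}"] by simp
  then show ?thesis using 0 \<beta>_ge \<beta>_less by (simp add: dev0_bound_def)
next
  case (Suc k)
  let ?a = "\<lambda>i. \<bar>green (int (Suc i) - int m) - green (int (Suc i) - int m + 1)\<bar>"
  let ?b = "\<lambda>i. \<bar>green (int (Suc i)) - green (int (Suc i) + 1)\<bar>"
  have "(\<Sum>i<k. \<bar>dev 0 (Suc i)\<bar>) \<le> (\<Sum>i<k. (?a i + (2 - \<beta>) * ?b i) / (2 * \<beta>))"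
  proof (rule sum_mono)
    fix i
    have "\<bar>p - (2 - \<beta>) * q\<bar> \<le> \<bar>p\<bar> + (2 - \<beta>) * \<bar>q\<bar>" for p q
      using abs_triangle_ineq4[of p "(2 - \<beta>) * q"] \<beta>_less by (simp add: abs_mult)
    then show "\<bar>dev 0 (Suc i)\<bar> \<le> (?a i + (2 - \<beta>) * ?b i) / (2 * \<beta>)"
      unfolding dev_0_Suc using \<beta>_ge by (simp add: abs_divide divide_right_mono del: of_nat_Suc)
  qed
  also have "\<dots> = ((\<Sum>i<k. ?a i) + (2 - \<beta>) * (\<Sum>i<k. ?b i)) / (2 * \<beta>)"
    by (simp only: sum.distrib flip: sum_divide_distrib sum_distrib_left)
  also have "\<dots> \<le> (gradient_bound + (2 - \<beta>) * gradient_bound) / (2 * \<beta>)"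
  proof (intro divide_right_mono add_mono mult_left_mono)
    \<comment> \<open>Both sums run over distinct arguments of \<open>green\<close>, so
      \<open>green_variation\<close> applies to each.\<close>
    have "inj_on (\<lambda>i. int (Suc i) - int m) {..<k}" "inj_on (\<lambda>i. int (Suc i)) {..<k}"
      by (auto simp: inj_on_def)
    then show "(\<Sum>i<k. ?a i) \<le> gradient_bound" "(\<Sum>i<k. ?b i) \<le> gradient_bound"
      using green_variation[of "(\<lambda>i. int (Suc i) - int m) ` {..<k}"] green_variation[of "(\<lambda>i. int (Suc i)) ` {..<k}"]
      by (simp_all add: sum.reindex del: of_nat_Suc)
  qed (use \<beta>_ge \<beta>_less in auto)
  finally have "(\<Sum>i<k. \<bar>dev 0 (Suc i)\<bar>) \<le> (3 - \<beta>) * gradient_bound / (2 * \<beta>)" by (simp add: algebra_simps)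
  moreover have "dev 0 0 = 1 - 1 / \<beta>" by (simp add: dev_def count_ext_0 count_ext_1)
  then have "\<bar>dev 0 0\<bar> = 1 - 1 / \<beta>" using \<beta>_ge by simp
  ultimately show ?thesis unfolding Suc sum.lessThan_Suc_shift dev0_bound_def by simp
qed

text \<open>Occurrences of a + 1 in an image come from occurrences of a, which gives
  \<open>dev_Suc\<close>. Each new letter thus adds one copy of the bound for the letter 0, scaled
  by 1 / beta^(a+1), and the deviation at index 0.\<close>

lemma sum_dev_le_partial:
  "(\<Sum>i<K. \<bar>dev a i\<bar>) \<le> dev0_bound + (dev0_bound + 1) * (\<Sum>j<a. 1 / \<beta> ^ Suc j)"
proof (induction a arbitrary: K)
  case 0
  then show ?case using sum_dev_0 by simp
next
  case (Suc a)
  have dev0_bound: "dev0_bound \<ge> 0" using sum_dev_0[of 0] by simp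
  have pos: "\<beta> ^ k > 0" for k using \<beta>_ge by simp
  have M0b: "dev0_bound / \<beta> ^ Suc a \<ge> 0" by (intro divide_nonneg_pos dev0_bound pos)
  show ?case
  proof (cases K)
    case 0
    then show ?thesis using dev0_bound \<beta>_ge by (simp add: sum_nonneg)
  next
    case (Suc k)
    have dev_Suc: "dev (Suc a) (Suc i) = dev a i + dev 0 (Suc i) / \<beta> ^ Suc a" for i
      using \<beta>_ge by (simp add: dev_def field_simps add.commute)
    have "(\<Sum>i<k. \<bar>dev (Suc a) (Suc i)\<bar>) \<le> (\<Sum>i<k. \<bar>dev a i\<bar> + \<bar>dev 0 (Suc i)\<bar> / \<beta> ^ Suc a)"
      unfolding dev_Suc using pos[of "Suc a"]
      by (intro sum_mono order.trans[OF abs_triangle_ineq]) (simp add: abs_divide)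
    also have "\<dots> = (\<Sum>i<k. \<bar>dev a i\<bar>) + (\<Sum>i<k. \<bar>dev 0 (Suc i)\<bar>) / \<beta> ^ Suc a"
      by (simp only: sum.distrib sum_divide_distrib)
    also have "(\<Sum>i<k. \<bar>dev 0 (Suc i)\<bar>) / \<beta> ^ Suc a \<le> dev0_bound / \<beta> ^ Suc a"
    proof (rule divide_right_mono)
      show "(\<Sum>i<k. \<bar>dev 0 (Suc i)\<bar>) \<le> dev0_bound"
        using sum_dev_0[of "Suc k"] unfolding sum.lessThan_Suc_shift by simp
    qed (rule less_imp_le[OF pos])
    finally have "(\<Sum>i<k. \<bar>dev (Suc a) (Suc i)\<bar>) \<le> (\<Sum>i<k. \<bar>dev a i\<bar>) + dev0_bound / \<beta> ^ Suc a" by simp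
    \<comment> \<open>The word 0 has no letter a + 1, so only the expected value remains.\<close>
    moreover have "\<bar>dev (Suc a) 0\<bar> \<le> 1 / \<beta> ^ Suc a"
    proof -
      have "\<bar>dev (Suc a) 0\<bar> = 1 / \<beta> ^ Suc (Suc a)" using pos[of "Suc (Suc a)"] by (simp add: dev_def count_ext_def)
      also have "\<dots> \<le> 1 / \<beta> ^ Suc a"
        using \<beta>_ge pos[of "Suc a"] by (intro divide_left_mono power_increasing mult_pos_pos pos) auto
      finally show ?thesis .
    qed
    ultimately show ?thesis using Suc.IH[of k]
      unfolding \<open>K = Suc k\<close> sum.lessThan_Suc_shift[of "\<lambda>i. \<bar>dev (Suc a) i\<bar>"] sum.lessThan_Suc[of _ a]
      by (simp add: algebra_simps add_divide_distrib)
  qed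
qed

lemma sum_dev_le: "(\<Sum>i<K. \<bar>dev a i\<bar>) \<le> dev0_bound + (dev0_bound + 1) / (\<beta> - 1)"
proof -
  have "(\<Sum>j<a. 1 / \<beta> ^ Suc j) \<le> 1 / (\<beta> - 1)"
  proof -
    have "(\<Sum>j<a. 1 / \<beta> ^ Suc j) = (1 - 1 / \<beta> ^ a) / (\<beta> - 1)"
    proof (induction a)
      case (Suc a)
      show ?case unfolding sum.lessThan_Suc Suc.IH using \<beta>_ge by (simp add: field_simps)
    qed simp
    also have "\<dots> \<le> 1 / (\<beta> - 1)" using \<beta>_ge by (intro divide_right_mono) auto
    finally show ?thesis .
  qed
  moreover have "dev0_bound \<ge> 0" using sum_dev_0[of 0] by simp
  ultimately have "(dev0_bound + 1) * (\<Sum>j<a. 1 / \<beta> ^ Suc j) \<le> (dev0_bound + 1) * (1 / (\<beta> - 1))"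
    by (intro mult_left_mono) auto
  with sum_dev_le_partial[of a K] show ?thesis by simp
qed

text \<open>Indices common to both prefixes cancel. What remains is a signed sum over the symmetric
  difference of \<open>I\<close> and \<open>J\<close>, so the absolute sum is counted once and not
  twice.\<close>

lemma discrepancy_bound:
  assumes "a < m"
  shows "\<bar>(count_list (stake n (bonacci_word m)) a - n / \<beta> ^ Suc a)
        - (count_list (stake n' (bonacci_word m)) a - n' / \<beta> ^ Suc a)\<bar> \<le> dev0_bound + (dev0_bound + 1) / (\<beta> - 1)"
proof -
  let ?u = "bonacci_word m"
  have u: "is_bonacci_word m ?u" using m by (intro is_bonacci_word_bonacci_word) simp
  have D: "\<exists>I. finite I \<and> count_list (stake n ?u) a - n / \<beta> ^ Suc a = (\<Sum>i\<in>I. dev a i)" for n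
  proof -
    obtain I where I: "finite I" "n = (\<Sum>i\<in>I. length (bonacci_iter m i))"
      "count_list (stake n ?u) a = (\<Sum>i\<in>I. count_list (bonacci_iter m i) a)"
      using prefix_count_decomposition[OF u, of n] assms by blast
    have *: "dev a i = real (count_list (bonacci_iter m i) a) - real (length (bonacci_iter m i)) / \<beta> ^ Suc a" for i
      using assms by (auto simp: dev_def count_ext_def count_bonacci_iter length_bonacci_iter nat_add_distrib nat_diff_distrib)
    have "count_list (stake n ?u) a - n / \<beta> ^ Suc a = (\<Sum>i\<in>I. dev a i)"
      unfolding * sum_subtractf sum_divide_distrib[symmetric] of_nat_sum[symmetric] I(2)[symmetric] I(3)[symmetric] ..
    with I(1) show ?thesis by blast
  qed
  obtain I J where fin: "finite I" "finite J"
    and eq: "count_list (stake n ?u) a - n / \<beta> ^ Suc a = (\<Sum>i\<in>I. dev a i)"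
      "count_list (stake n' ?u) a - n' / \<beta> ^ Suc a = (\<Sum>i\<in>J. dev a i)"
    using D by metis
  have "(\<Sum>i\<in>I. dev a i) - (\<Sum>i\<in>J. dev a i) = (\<Sum>i\<in>I - J. dev a i) - (\<Sum>i\<in>J - I. dev a i)"
    using sum.Int_Diff[OF fin(1), of "dev a" J] sum.Int_Diff[OF fin(2), of "dev a" I] by (simp add: Int_commute)
  also have "\<bar>\<dots>\<bar> \<le> (\<Sum>i\<in>I - J. \<bar>dev a i\<bar>) + (\<Sum>i\<in>J - I. \<bar>dev a i\<bar>)"
    using sum_abs[of "dev a" "I - J"] sum_abs[of "dev a" "J - I"] by linarith
  also have "\<dots> = (\<Sum>i\<in>(I - J) \<union> (J - I). \<bar>dev a i\<bar>)"
    using fin by (intro sum.union_disjoint[symmetric]) auto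
  also have "\<dots> \<le> (\<Sum>i<Suc (Max (insert 0 (I \<union> J))). \<bar>dev a i\<bar>)"
    using fin by (intro sum_mono2) (auto simp: less_Suc_eq_le)
  also have "\<dots> \<le> dev0_bound + (dev0_bound + 1) / (\<beta> - 1)" by (rule sum_dev_le)
  finally show ?thesis unfolding eq .
qed

text \<open>For beta = 2 the left side would be \<open>gradient_bound\<close> + 4, at most 52/100 m
  + 10. The 2 to spare absorb the error from \<open>2 - \<beta>\<close>, which
  \<open>eta_small\<close> controls.\<close>

lemma twice_discrepancy_less: "2 * (dev0_bound + (dev0_bound + 1) / (\<beta> - 1)) < 52 / 100 * real m + 12"
proof -
  have B: "gradient_bound \<le> 52 / 100 * real m + 6"
  proof -
    have "gradient_bound \<le> 1 + (104 / 100 * real m + 10) / 2"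
      unfolding gradient_bound_def by (intro add_left_mono divide_right_mono gradient_bound_linear m refl) simp
    then show ?thesis by (simp add: field_simps)
  qed
  have "2 * (dev0_bound + (dev0_bound + 1) / (\<beta> - 1)) = 2 + ((3 - \<beta>) * gradient_bound + 2) / (\<beta> - 1)"
    using \<beta>_ge by (simp add: dev0_bound_def divide_simps) (simp add: algebra_simps)
  also have "\<dots> < 52 / 100 * real m + 12"
  proof -
    \<comment> \<open>The factor 4/3 fits m \<ge> 5 and leaves a bound of 4/3 after
      \<open>eta_small\<close>.\<close>
    have "(2 - \<beta>) * (104 / 100 * real m + 16) \<le> (2 - \<beta>) * (4 * (real m + 1)) * (4 / 3)"
      unfolding mult.assoc[of "2 - \<beta>"] using \<beta>_less m by (intro mult_left_mono) auto
    then have "(2 - \<beta>) * (104 / 100 * real m + 16) < 2"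
      using eta_small by linarith
    moreover have "(52 / 100 * real m + 10) * (\<beta> - 1) - ((3 - \<beta>) * (52 / 100 * real m + 6) + 2)
        = 2 - (2 - \<beta>) * (104 / 100 * real m + 16)"
      by (simp add: field_simps)
    moreover have "(3 - \<beta>) * gradient_bound \<le> (3 - \<beta>) * (52 / 100 * real m + 6)"
      using B \<beta>_less by (intro mult_left_mono) auto
    ultimately have "(3 - \<beta>) * gradient_bound + 2 < (52 / 100 * real m + 10) * (\<beta> - 1)"
      by linarith
    then have "((3 - \<beta>) * gradient_bound + 2) / (\<beta> - 1) < 52 / 100 * real m + 10"
      using \<beta>_ge by (simp add: pos_divide_less_eq)
    then show ?thesis by simp
  qed
  finally show ?thesis .
qed

end

theorem theorem6p1:
  fixes m :: nat
  assumes "m \<ge> 5"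
  shows "balanced_word {..<m} (\<lfloor>kappa * real m\<rfloor> + 12) (bonacci_word m)"
proof -
  obtain \<beta> :: real where "bonacci_root m \<beta>"
    using bonacci_root_exists[OF assms] assms by (auto simp: bonacci_root_def)
  then interpret bonacci_root m \<beta> .
  let ?u = "bonacci_word m"
  show ?thesis
    unfolding balanced_word_def
  proof (intro allI impI ballI)
    fix w v :: "nat list" and a
    assume "is_factor w ?u" "is_factor v ?u" "length w = length v" "a \<in> {..<m}"
    then obtain i j n where w: "w = stake n (sdrop i ?u)" and v: "v = stake n (sdrop j ?u)" and a: "a < m"
      by (auto simp: is_factor_def)
    have count: "count_list (stake (k + n) ?u) a = count_list (stake k ?u) a + count_list (stake n (sdrop k ?u)) a" for k
      unfolding stake_add[symmetric] count_list_append ..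
    \<comment> \<open>The expected count of \<open>a\<close> in a factor of length n. Both factors
      are compared with it as differences of prefixes, which costs the discrepancy twice.\<close>
    define r where "r = real n / \<beta> ^ Suc a"
    have r: "real (k + n) / \<beta> ^ Suc a = real k / \<beta> ^ Suc a + r" for k
      by (simp add: r_def add_divide_distrib)
    have "real (count_list w a) - r \<le> dev0_bound + (dev0_bound + 1) / (\<beta> - 1)"
      using discrepancy_bound[OF a, of "i + n" i] unfolding r count w by simp
    moreover have "r - real (count_list v a) \<le> dev0_bound + (dev0_bound + 1) / (\<beta> - 1)"
      using discrepancy_bound[OF a, of j "j + n"] unfolding r count v by simp
    ultimately have "real (count_list w a) - real (count_list v a) < 52 / 100 * real m + 12"
      using twice_discrepancy_less unfolding mult_2 by linarith
    also have "\<dots> \<le> kappa * real m + 12"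
      using kappa_lower by (intro add_right_mono mult_right_mono) auto
    finally show "int (count_list w a) - int (count_list v a) \<le> \<lfloor>kappa * real m\<rfloor> + 12"
      by linarith
  qed
qed

end
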